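(* Let $D=(E,\mathcal{F})$ be a delta-matroid and let $<$ be any total order on $E$. For $F\in\mathcal{F}$, let $i(F)$ be the number of points of $E$ that are internal, active, and orientable with respect to $F$, and let $j(F)$ be the number of points of $E$ that are external, active, and orientable with respect to $F$. Then the two-variable interlace polynomial $\bar{q}(D;x,y)$ satisfies $$\bar{q}(D;x,y)=\sum_{F\in\mathcal{F}} x^{|F|}\,(1+y/x)^{i(F)}\,(1+xy)^{j(F)} .$$
   Context: A delta-matroid is a pair $D=(E,\mathcal{F})$ where $E$ is a finite set and $\mathcal{F}$ is a nonempty collection of subsets of $E$ (the feasible sets) such that for all $X,Y\in\mathcal{F}$ and $a\in X\Delta Y$ there exists $b\in X\Delta Y$, not necessarily distinct from $a$, with $X\Delta\{a,b\}\in\mathcal{F}$ ($\Delta$ is symmetric difference). For $X\subseteq E$ the twist is $D*X=(E,\{X\Delta F: F\in\mathcal{F}\})$, which is again a delta-matroid. Interlace polynomial: let $r_{\min}(D)$ denote the minimum cardinality of a feasible set of $D$. The two-variable interlace polynomial of $D$ is $\bar{q}(D;x,y)=\sum_{A\subseteq E} x^{|A|}y^{r_{\min}(D*A)}$, with $x,y$ indeterminates. Activities: fix $F\in\mathcal{F}$. A point $a\in E$ is $F$-nonorientable if $\{a\}$ is feasible in $D*F$, and $F$-orientable (orientable with respect to $F$) otherwise. A pair $\{a,b\}\subseteq E$, $a\neq b$, is $F$-paired if $\{a,b\}$ is feasible in $D*F$, and $F$-separated otherwise. Distinct points $a,b$ are $F$-interlaced if either (1) at most one of $a,b$ is $F$-nonorientable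 and $\{a,b\}$ is $F$-paired, or (2) both $a$ and $b$ are $F$-nonorientable and $\{a,b\}$ is $F$-separated. Given a total order $<$ on $E$, a point $a$ is active with respect to $F$ if $a$ is not $F$-interlaced with any lower-ordered point. A point $a$ is internal (with respect to $F$) if $a\in F$ and external otherwise. *)

theory Defs
  imports "HOL-Computational_Algebra.Polynomial_Factorial"
begin

record 'a set_system =
  ground :: "'a set"
  feasible :: "'a set set"

definition delta_matroid :: "'a set_system \<Rightarrow> bool" where
  "delta_matroid D \<longleftrightarrow>
     finite (ground D) \<and> feasible D \<noteq> {} \<and> feasible D \<subseteq> Pow (ground D) \<and>
     (\<forall>X\<in>feasible D. \<forall>Y\<in>feasible D. \<forall>a\<in>sym_diff X Y.
        \<exists>b\<in>sym_diff X Y. sym_diff X {a, b} \<in> feasible D)"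

definition twist :: "'a set_system \<Rightarrow> 'a set \<Rightarrow> 'a set_system" where
  "twist D X = \<lparr>ground = ground D, feasible = {sym_diff X F | F. F \<in> feasible D}\<rparr>"

definition r_min :: "'a set_system \<Rightarrow> nat" where
  "r_min D = Min (card ` feasible D)"


text \<open>Bivariate polynomials over the integers: \<open>y\<close> is the outer indeterminate, and
  \<open>x\<close> is the indeterminate of the coefficient ring.\<close>

definition poly_x :: "int poly poly" where
  "poly_x = [:[:0, 1:]:]"

definition poly_y :: "int poly poly" where
  "poly_y = [:0, 1:]"

definition interlace_poly :: "'a set_system \<Rightarrow> int poly poly" where
  "interlace_poly D =
     (\<Sum>A\<in>Pow (ground D). poly_x ^ card A * poly_y ^ r_min (twist D A))"


definition nonorientable :: "'a set_system \<Rightarrow> 'a set \<Rightarrow> 'a \<Rightarrow> bool" where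
  "nonorientable D F a \<longleftrightarrow> {a} \<in> feasible (twist D F)"

abbreviation orientable :: "'a set_system \<Rightarrow> 'a set \<Rightarrow> 'a \<Rightarrow> bool" where
  "orientable D F a \<equiv> \<not> nonorientable D F a"

definition paired :: "'a set_system \<Rightarrow> 'a set \<Rightarrow> 'a \<Rightarrow> 'a \<Rightarrow> bool" where
  "paired D F a b \<longleftrightarrow> {a, b} \<in> feasible (twist D F)"

abbreviation separated :: "'a set_system \<Rightarrow> 'a set \<Rightarrow> 'a \<Rightarrow> 'a \<Rightarrow> bool" where
  "separated D F a b \<equiv> \<not> paired D F a b"

definition interlaced :: "'a set_system \<Rightarrow> 'a set \<Rightarrow> 'a \<Rightarrow> 'a \<Rightarrow> bool" where
  "interlaced D F a b \<longleftrightarrow> a \<noteq> b \<and>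
     (\<not> (nonorientable D F a \<and> nonorientable D F b) \<and> paired D F a b \<or>
      nonorientable D F a \<and> nonorientable D F b \<and> separated D F a b)"

text \<open>The order is given as a strict relation \<open>r\<close>: \<open>(b, a) \<in> r\<close> means \<open>b < a\<close>.\<close>

definition active :: "'a set_system \<Rightarrow> 'a rel \<Rightarrow> 'a set \<Rightarrow> 'a \<Rightarrow> bool" where
  "active D r F a \<longleftrightarrow> (\<forall>b\<in>ground D. (b, a) \<in> r \<longrightarrow> \<not> interlaced D F a b)"

definition internal_activity :: "'a set_system \<Rightarrow> 'a rel \<Rightarrow> 'a set \<Rightarrow> nat" where
  "internal_activity D r F =
     card {a \<in> ground D. a \<in> F \<and> active D r F a \<and> orientable D F a}"

definition external_activity :: "'a set_system \<Rightarrow> 'a rel \<Rightarrow> 'a set \<Rightarrow> nat" where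
  "external_activity D r F =
     card {a \<in> ground D. a \<notin> F \<and> active D r F a \<and> orientable D F a}"


text \<open>The indeterminates in the field of fractions of the polynomial ring, where the
  quotient \<open>y / x\<close> makes sense.\<close>

abbreviation frac_x :: "int poly poly fract" where
  "frac_x \<equiv> to_fract poly_x"

abbreviation frac_y :: "int poly poly fract" where
  "frac_y \<equiv> to_fract poly_y"

end

(*
  The theorem says that the sets F \<triangle> S with F feasible and S a set of points that are active
  and orientable with respect to F run through every A \<subseteq> E exactly once, and that
  |S| = r_min(D * A) when A = F \<triangle> S.  Orientability and activity depend on D * F only, so
  after twisting by A it is enough to treat A = {}: a delta-matroid has exactly one feasible
  set F all of whose points are active and orientable with respect to F, and |F| is the
  minimum cardinality of a feasible set.

  Such an F contains no smaller feasible set (exchanging towards one would remove an interlaced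
  pair from F), and inclusion-minimal feasible sets have minimum cardinality.  Among the feasible
  sets of minimum cardinality, which are the bases of a matroid, the condition on F says that no
  point of F can be exchanged for a lower one, and this singles out the greedy basis.
*)
theory Submission
  imports Defs
begin

section \<open>Twists of delta-matroids\<close>

lemma sym_diff_assoc: "sym_diff (sym_diff A B) C = sym_diff A (sym_diff B C)"
  by blast

lemma sym_diff_cancel_left: "sym_diff A (sym_diff A B) = B"
  by blast

lemma mem_feasible_twist: "A \<in> feasible (twist D X) \<longleftrightarrow> sym_diff X A \<in> feasible D"
proof -
  have "A \<in> feasible (twist D X) \<longleftrightarrow> (\<exists>F. A = sym_diff X F \<and> F \<in> feasible D)"
    by (simp add: twist_def)
  also have "\<dots> \<longleftrightarrow> (\<exists>F. F = sym_diff X A \<and> F \<in> feasible D)"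
    by (metis sym_diff_cancel_left)
  finally show ?thesis by simp
qed

lemma ground_twist [simp]: "ground (twist D X) = ground D"
  by (simp add: twist_def)

lemma twist_twist: "twist (twist D X) Y = twist D (sym_diff X Y)"
proof -
  have "feasible (twist (twist D X) Y) = feasible (twist D (sym_diff X Y))"
    by (simp only: set_eq_iff mem_feasible_twist sym_diff_assoc simp_thms)
  then show ?thesis by (simp add: twist_def)
qed

lemma delta_matroid_exchange:
  assumes "delta_matroid D" "X \<in> feasible D" "Y \<in> feasible D" "a \<in> sym_diff X Y"
  obtains b where "b \<in> sym_diff X Y" "sym_diff X {a, b} \<in> feasible D"
  using assms unfolding delta_matroid_def by meson

lemma finite_ground: "delta_matroid D \<Longrightarrow> finite (ground D)"
  by (simp add: delta_matroid_def)

lemma feasible_subset_ground: "delta_matroid D \<Longrightarrow> F \<in> feasible D \<Longrightarrow> F \<subseteq> ground D"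
  by (auto simp: delta_matroid_def)

lemma finite_feasible_set: "delta_matroid D \<Longrightarrow> F \<in> feasible D \<Longrightarrow> finite F"
  using feasible_subset_ground finite_ground finite_subset by metis

lemma finite_feasible: "delta_matroid D \<Longrightarrow> finite (feasible D)"
  unfolding delta_matroid_def by (meson finite_Pow_iff finite_subset)

lemma delta_matroid_twist:
  assumes D: "delta_matroid D" and A: "A \<subseteq> ground D"
  shows "delta_matroid (twist D A)"
  unfolding delta_matroid_def
proof (intro conjI ballI)
  show "finite (ground (twist D A))" using D by (simp add: finite_ground)
  show "feasible (twist D A) \<noteq> {}" using D by (auto simp: delta_matroid_def twist_def)
  show "feasible (twist D A) \<subseteq> Pow (ground (twist D A))"
    using feasible_subset_ground[OF D] A by (fastforce simp: twist_def)
next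
  fix X Y a
  assume X: "X \<in> feasible (twist D A)" and Y: "Y \<in> feasible (twist D A)"
    and a: "a \<in> sym_diff X Y"
  \<comment> \<open>The twisting set cancels in the symmetric difference of two twisted sets, so the
    points available for exchange are the same in \<open>D\<close> and in its twist.\<close>
  have eq: "sym_diff (sym_diff A X) (sym_diff A Y) = sym_diff X Y" by blast
  have "sym_diff A X \<in> feasible D" "sym_diff A Y \<in> feasible D"
    using X Y by (simp_all only: mem_feasible_twist)
  moreover have "a \<in> sym_diff (sym_diff A X) (sym_diff A Y)" using a by (simp only: eq)
  ultimately obtain b where b: "b \<in> sym_diff (sym_diff A X) (sym_diff A Y)"
      "sym_diff (sym_diff A X) {a, b} \<in> feasible D"
    by (rule delta_matroid_exchange[OF D])
  have "sym_diff X {a, b} \<in> feasible (twist D A)"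
    using b(2) by (simp only: mem_feasible_twist sym_diff_assoc)
  then show "\<exists>b\<in>sym_diff X Y. sym_diff X {a, b} \<in> feasible (twist D A)"
    using b(1) unfolding eq by (rule bexI)
qed

section \<open>Feasible sets of minimum cardinality\<close>

lemma r_min_le: "delta_matroid D \<Longrightarrow> F \<in> feasible D \<Longrightarrow> r_min D \<le> card F"
  unfolding r_min_def by (simp add: finite_feasible)

lemma r_min_attained:
  assumes "delta_matroid D"
  obtains F where "F \<in> feasible D" "card F = r_min D"
proof -
  have "r_min D \<in> card ` feasible D"
    unfolding r_min_def using assms
    by (intro Min_in) (auto simp: finite_feasible delta_matroid_def)
  then show ?thesis using that by auto
qed

text \<open>If the point \<open>b\<close> supplied by the exchange axiom lay in \<open>Y\<close>,
  possibly with \<open>b = a\<close>, then \<open>Y\<close> would only lose points and fall below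
  the minimum. So the exchange is a swap, as for bases of a matroid.\<close>

lemma minimum_feasible_exchange:
  assumes D: "delta_matroid D"
    and Y: "Y \<in> feasible D" "card Y = r_min D"
    and F: "F \<in> feasible D" and a: "a \<in> Y - F"
  obtains b where "b \<in> F - Y" "insert b (Y - {a}) \<in> feasible D"
proof -
  from a have "a \<in> sym_diff Y F" by blast
  then obtain b where b: "b \<in> sym_diff Y F" "sym_diff Y {a, b} \<in> feasible D"
    by (rule delta_matroid_exchange[OF D Y(1) F])
  have "b \<notin> Y"
  proof
    assume "b \<in> Y"
    then have "sym_diff Y {a, b} \<subset> Y" using a by blast
    then have "card (sym_diff Y {a, b}) < r_min D"
      using psubset_card_mono[OF finite_feasible_set[OF D Y(1)]] Y(2) by simp
    then show False using r_min_le[OF D b(2)] by simp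
  qed
  moreover from this have "sym_diff Y {a, b} = insert b (Y - {a})" using a by blast
  ultimately show ?thesis using that b by auto
qed

lemma card_insert_Diff_singleton:
  assumes "finite A" "a \<in> A" "b \<notin> A"
  shows "card (insert b (A - {a})) = card A"
proof -
  have "card (insert b (A - {a})) = Suc (card (A - {a}))"
    using assms by (intro card_insert_disjoint) auto
  then show ?thesis by (simp only: card_Suc_Diff1[OF assms(1,2)])
qed

text \<open>Take a feasible set \<open>Y\<close> of minimum cardinality with
  \<open>card (Y - F)\<close> least. A point of \<open>Y - F\<close> could be swapped for one of
  \<open>F - Y\<close>, which lowers that number; hence \<open>Y\<close> lies inside
  \<open>F\<close> and equals it by minimality.\<close>

lemma inclusion_minimal_card:
  assumes D: "delta_matroid D" and F: "F \<in> feasible D"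
    and minimal: "\<And>Y. Y \<in> feasible D \<Longrightarrow> Y \<subseteq> F \<Longrightarrow> Y = F"
  shows "card F = r_min D"
proof -
  define P where "P = (\<lambda>Y. Y \<in> feasible D \<and> card Y = r_min D)"
  obtain Y0 where "P Y0" using r_min_attained[OF D] by (auto simp: P_def)
  then obtain Y where "P Y" and least: "\<And>Z. P Z \<Longrightarrow> card (Y - F) \<le> card (Z - F)"
    using ex_has_least_nat[of P Y0 "\<lambda>Y. card (Y - F)"] by blast
  then have Y: "Y \<in> feasible D" "card Y = r_min D" by (auto simp: P_def)
  note finY = finite_feasible_set[OF D Y(1)]
  have "Y \<subseteq> F"
  proof (rule ccontr)
    assume "\<not> Y \<subseteq> F"
    then obtain a where a: "a \<in> Y - F" by blast
    obtain b where b: "b \<in> F - Y" and feas: "insert b (Y - {a}) \<in> feasible D"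
      using minimum_feasible_exchange[OF D Y F a] .
    have "card (insert b (Y - {a})) = card Y"
      using a b finY by (intro card_insert_Diff_singleton) auto
    then have "P (insert b (Y - {a}))" using feas Y(2) by (simp add: P_def)
    then have "card (Y - F) \<le> card (insert b (Y - {a}) - F)" by (rule least)
    moreover have "insert b (Y - {a}) - F = Y - F - {a}" using b by auto
    moreover have "card (Y - F - {a}) < card (Y - F)"
      using a finY by (intro card_Diff1_less) auto
    ultimately show False by simp
  qed
  then show ?thesis using minimal[OF Y(1)] Y(2) by simp
qed

section \<open>Activity as a greedy condition\<close>

definition active_orientable :: "'a set_system \<Rightarrow> 'a rel \<Rightarrow> 'a set \<Rightarrow> 'a set" where
  "active_orientable D r F = {a \<in> ground D. active D r F a \<and> orientable D F a}"

text \<open>Orientability and pairing see \<open>D\<close> only through \<open>twist D F\<close>,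
  and successive twists combine by symmetric difference. This carries results about one
  delta-matroid over to all its twists.\<close>

lemma active_orientable_twist:
  "active_orientable (twist D A) r F = active_orientable D r (sym_diff A F)"
  unfolding active_orientable_def active_def interlaced_def nonorientable_def paired_def
    twist_twist ground_twist ..

lemma strict_linear_order_onD:
  assumes "strict_linear_order_on E r"
  shows "trans r" "\<And>a. (a, a) \<notin> r"
    "\<And>a b. a \<in> E \<Longrightarrow> b \<in> E \<Longrightarrow> a \<noteq> b \<Longrightarrow> (a, b) \<in> r \<or> (b, a) \<in> r"
  using assms by (auto simp: strict_linear_order_on_def irrefl_def total_on_def)

text \<open>The number of lower points turns the order into a numerical rank. It is strictly
  monotone: transitivity gives the inclusion, and \<open>a\<close> is below \<open>b\<close> but not
  below itself.\<close>

lemma card_below_mono: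
  assumes r: "strict_linear_order_on E r" and "finite E" "a \<in> E" "(a, b) \<in> r"
  shows "card {c \<in> E. (c, a) \<in> r} < card {c \<in> E. (c, b) \<in> r}"
proof (rule psubset_card_mono)
  show "{c \<in> E. (c, a) \<in> r} \<subset> {c \<in> E. (c, b) \<in> r}"
    using strict_linear_order_onD[OF r] assms(3,4) by (blast dest: transD)
qed (use \<open>finite E\<close> in auto)

lemma strict_linear_order_on_greatest:
  assumes r: "strict_linear_order_on E r" and E: "finite E" and S: "S \<subseteq> E" "S \<noteq> {}"
  shows "\<exists>z\<in>S. \<forall>b\<in>S - {z}. (b, z) \<in> r"
proof -
  define w where "w a = card {c \<in> E. (c, a) \<in> r}" for a
  have "finite S" using S E finite_subset by blast
  then have "Max (w ` S) \<in> w ` S" using S by (intro Max_in) auto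
  then obtain z where z: "z \<in> S" "w z = Max (w ` S)" by auto
  have "(b, z) \<in> r" if b: "b \<in> S" "b \<noteq> z" for b
  proof -
    have "w b \<le> w z" using z(2) b \<open>finite S\<close> by simp
    then have "(z, b) \<notin> r"
      using card_below_mono[OF r E, of z b] z(1) S by (auto simp: w_def)
    then show ?thesis using strict_linear_order_onD(3)[OF r] b z(1) S by blast
  qed
  then show ?thesis using z(1) by blast
qed

text \<open>A feasible proper subset of \<open>F\<close> would yield, by exchange, points
  \<open>a\<close> and \<open>b\<close> of \<open>F\<close> whose removal is feasible. Orientability
  excludes \<open>a = b\<close>, so they form a paired couple of orientable points, and such points
  are interlaced.\<close>

lemma card_eq_r_min_if_active_orientable:
  assumes D: "delta_matroid D" and r: "strict_linear_order_on (ground D) r"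
    and F: "F \<in> feasible D" and act: "F \<subseteq> active_orientable D r F"
  shows "card F = r_min D"
proof (rule inclusion_minimal_card[OF D F])
  fix Y assume Y: "Y \<in> feasible D" "Y \<subseteq> F"
  show "Y = F"
  proof (rule ccontr)
    assume "Y \<noteq> F"
    then obtain a where a: "a \<in> F - Y" using Y by blast
    then have "a \<in> sym_diff F Y" by blast
    then obtain b where b: "b \<in> sym_diff F Y" "sym_diff F {a, b} \<in> feasible D"
      by (rule delta_matroid_exchange[OF D F Y(1)])
    have mem: "a \<in> F" "b \<in> F" using a b(1) Y by auto
    then have g: "a \<in> ground D" "b \<in> ground D" using feasible_subset_ground[OF D F] by auto
    have ori: "orientable D F a" "orientable D F b"
      and acts: "active D r F a" "active D r F b"
      using act mem by (auto simp: active_orientable_def)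
    have p: "paired D F a b" using b(2) by (simp only: paired_def mem_feasible_twist)
    then have ne: "a \<noteq> b" using ori by (auto simp: paired_def nonorientable_def)
    have "interlaced D F a b" "interlaced D F b a"
      using p ori ne by (auto simp: interlaced_def paired_def insert_commute)
    \<comment> \<open>The higher of the two points is interlaced with the lower one, so it cannot be
      active.\<close>
    then show False
      using strict_linear_order_onD(3)[OF r g ne] acts g by (auto simp: active_def)
  qed
qed

text \<open>Nothing can be removed from a feasible set of minimum cardinality. Hence its points are
  orientable and separated from one another, and a point \<open>a\<close> of \<open>F\<close> is
  interlaced with \<open>c\<close> exactly when \<open>c\<close> lies outside \<open>F\<close> and
  can replace \<open>a\<close>. Activity thus becomes local optimality of a matroid basis.\<close>

lemma subset_active_orientable_iff:
  assumes D: "delta_matroid D" and F: "F \<in> feasible D" "card F = r_min D"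
  shows "F \<subseteq> active_orientable D r F \<longleftrightarrow>
    (\<forall>a\<in>F. \<forall>c\<in>ground D - F. (c, a) \<in> r \<longrightarrow> insert c (F - {a}) \<notin> feasible D)"
proof -
  note finF = finite_feasible_set[OF D F(1)]
  have smaller: "sym_diff F S \<notin> feasible D" if S: "S \<subseteq> F" "S \<noteq> {}" for S
  proof
    assume *: "sym_diff F S \<in> feasible D"
    have "sym_diff F S \<subset> F" using S by auto
    from psubset_card_mono[OF finF this] show False using r_min_le[OF D *] F(2) by simp
  qed
  have paired: "paired D F a c \<longleftrightarrow> sym_diff F {a, c} \<in> feasible D" for a c
    by (simp only: paired_def mem_feasible_twist)
  have ori: "orientable D F a" if "a \<in> F" for a
    unfolding nonorientable_def mem_feasible_twist using that by (intro smaller) auto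
  have inter: "interlaced D F a c \<longleftrightarrow> c \<notin> F \<and> insert c (F - {a}) \<in> feasible D"
    if "a \<in> F" for a c
  proof (cases "c \<in> F")
    case True
    then have "\<not> paired D F a c" unfolding paired using that by (intro smaller) auto
    then show ?thesis using True ori that by (simp add: interlaced_def)
  next
    case False
    then have eq: "sym_diff F {a, c} = insert c (F - {a})" using that by auto
    have "a \<noteq> c" using False that by auto
    then have "interlaced D F a c \<longleftrightarrow> paired D F a c"
      using ori[OF that] by (simp add: interlaced_def)
    then show ?thesis using False by (simp only: paired eq simp_thms)
  qed
  have "F \<subseteq> active_orientable D r F \<longleftrightarrow> (\<forall>a\<in>F. active D r F a)"
    using feasible_subset_ground[OF D F(1)] ori by (auto simp: active_orientable_def)
  also have "\<dots> \<longleftrightarrow>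
      (\<forall>a\<in>F. \<forall>c\<in>ground D. (c, a) \<in> r \<longrightarrow> \<not> (c \<notin> F \<and> insert c (F - {a}) \<in> feasible D))"
    by (simp add: active_def inter)
  finally show ?thesis by blast
qed

text \<open>Among the feasible sets of minimum cardinality take one whose total rank is least;
  replacing a point by a lower one would decrease the total.\<close>

lemma ex_active_orientable:
  assumes D: "delta_matroid D" and r: "strict_linear_order_on (ground D) r"
  shows "\<exists>F\<in>feasible D. F \<subseteq> active_orientable D r F"
proof -
  define w where "w a = card {c \<in> ground D. (c, a) \<in> r}" for a
  define P where "P = (\<lambda>Y. Y \<in> feasible D \<and> card Y = r_min D)"
  obtain Y0 where "P Y0" using r_min_attained[OF D] by (auto simp: P_def)
  then obtain F where "P F" and least: "\<And>Z. P Z \<Longrightarrow> sum w F \<le> sum w Z"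
    using ex_has_least_nat[of P Y0 "sum w"] by blast
  then have F: "F \<in> feasible D" "card F = r_min D" by (auto simp: P_def)
  note finF = finite_feasible_set[OF D F(1)]
  have "insert c (F - {a}) \<notin> feasible D"
    if a: "a \<in> F" and c: "c \<in> ground D - F" "(c, a) \<in> r" for a c
  proof
    assume feas: "insert c (F - {a}) \<in> feasible D"
    have "card (insert c (F - {a})) = card F"
      using a c finF by (intro card_insert_Diff_singleton) auto
    then have "P (insert c (F - {a}))" using feas F(2) by (simp add: P_def)
    then have "sum w F \<le> sum w (insert c (F - {a}))" by (rule least)
    moreover have "sum w (insert c (F - {a})) = w c + sum w (F - {a})"
      using c finF by simp
    moreover have "sum w F = w a + sum w (F - {a})"
      using a finF by (simp add: sum.remove)
    moreover have "w c < w a"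
      using card_below_mono[OF r finite_ground[OF D]] c by (simp add: w_def)
    ultimately show False by simp
  qed
  then have "F \<subseteq> active_orientable D r F"
    by (intro iffD2[OF subset_active_orientable_iff[OF D F]] ballI impI)
  with F(1) show ?thesis ..
qed

text \<open>Let \<open>z\<close> be the greatest point in which the two sets differ. Exchanging
  \<open>z\<close> out of the set containing it, towards the other set, brings in a point of their
  difference, which is lower than \<open>z\<close>; this contradicts the greedy condition.\<close>

lemma active_orientable_unique:
  assumes D: "delta_matroid D" and r: "strict_linear_order_on (ground D) r"
    and F: "F \<in> feasible D" "F \<subseteq> active_orientable D r F"
    and G: "G \<in> feasible D" "G \<subseteq> active_orientable D r G"
  shows "F = G"
proof (rule ccontr)
  assume "F \<noteq> G"
  then have "sym_diff F G \<noteq> {}" by blast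
  have "sym_diff F G \<subseteq> ground D"
    using feasible_subset_ground[OF D F(1)] feasible_subset_ground[OF D G(1)] by blast
  from strict_linear_order_on_greatest[OF r finite_ground[OF D] this \<open>sym_diff F G \<noteq> {}\<close>]
  obtain z where z: "z \<in> sym_diff F G" and top: "\<forall>b\<in>sym_diff F G - {z}. (b, z) \<in> r" ..
  \<comment> \<open>Stated for variable \<open>X\<close> and \<open>Y\<close> so that it serves both
    for \<open>z\<close> in \<open>F\<close> and for \<open>z\<close> in \<open>G\<close>.\<close>
  have False
    if X: "X \<in> feasible D" "X \<subseteq> active_orientable D r X" and Y: "Y \<in> feasible D"
      and XY: "sym_diff X Y = sym_diff F G" and zX: "z \<in> X - Y" for X Y
  proof -
    have min: "card X = r_min D" using card_eq_r_min_if_active_orientable[OF D r X] .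
    obtain b where b: "b \<in> Y - X" "insert b (X - {z}) \<in> feasible D"
      using minimum_feasible_exchange[OF D X(1) min Y zX] .
    have "b \<in> sym_diff F G" using b(1) XY by blast
    moreover have "b \<noteq> z" using b(1) zX by blast
    ultimately have "(b, z) \<in> r" using top by simp
    moreover have "b \<in> ground D - X" using b(1) feasible_subset_ground[OF D Y] by blast
    moreover have "z \<in> X" using zX by simp
    ultimately show False
      using iffD1[OF subset_active_orientable_iff[OF D X(1) min] X(2)] b(2) by simp
  qed
  note no_top = this
  from z show False
  proof
    assume "z \<in> F - G"
    then show False by (rule no_top[OF F G(1) refl])
  next
    assume "z \<in> G - F"
    then show False by (rule no_top[OF G F(1) Un_commute])
  qed
qed

section \<open>Each subset of the ground set arises once\<close>

lemma bij_betw_active_orientable: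
  assumes D: "delta_matroid D" and r: "strict_linear_order_on (ground D) r"
  shows "bij_betw (\<lambda>(F, S). sym_diff F S)
    (SIGMA F : feasible D. Pow (active_orientable D r F)) (Pow (ground D))"
proof -
  let ?Z = "SIGMA F : feasible D. Pow (active_orientable D r F)"
  have sub: "sym_diff F S \<subseteq> ground D" if "F \<in> feasible D" "S \<subseteq> active_orientable D r F" for F S
    using that feasible_subset_ground[OF D] by (fastforce simp: active_orientable_def)
  \<comment> \<open>With \<open>A = sym_diff F S\<close>, twisting by \<open>A\<close> moves the
    role of \<open>F\<close> to \<open>S\<close>: in \<open>twist D A\<close> the set
    \<open>S\<close> is feasible and all its points are active and orientable with respect to it.
    Uniqueness of such a set gives injectivity, existence gives surjectivity.\<close>
  have tw: "S \<in> feasible (twist D (sym_diff F S)) \<and>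
      S \<subseteq> active_orientable (twist D (sym_diff F S)) r S"
    if "F \<in> feasible D" "S \<subseteq> active_orientable D r F" for F S
  proof -
    have "sym_diff (sym_diff F S) S = F" by blast
    then show ?thesis using that by (simp only: mem_feasible_twist active_orientable_twist simp_thms)
  qed
  have "inj_on (\<lambda>(F, S). sym_diff F S) ?Z"
  proof (rule inj_onI)
    fix p q
    assume p: "p \<in> ?Z" and q: "q \<in> ?Z"
      and eq: "(case p of (F, S) \<Rightarrow> sym_diff F S) = (case q of (F, S) \<Rightarrow> sym_diff F S)"
    obtain F S G T where pq: "p = (F, S)" "q = (G, T)" by (cases p, cases q)
    have FS: "F \<in> feasible D" "S \<subseteq> active_orientable D r F"
      and GT: "G \<in> feasible D" "T \<subseteq> active_orientable D r G"
      using p q by (auto simp: pq)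
    have A: "sym_diff F S = sym_diff G T" using eq by (simp only: pq prod.case)
    have r': "strict_linear_order_on (ground (twist D (sym_diff F S))) r" using r by simp
    have "S = T"
      using active_orientable_unique[OF delta_matroid_twist[OF D sub[OF FS]] r', of S T]
        tw[OF FS] tw[OF GT] unfolding A by blast
    have "F = sym_diff (sym_diff F S) S" by auto
    also have "\<dots> = sym_diff (sym_diff G T) T" unfolding A unfolding \<open>S = T\<close> ..
    also have "\<dots> = G" by auto
    finally show "p = q" using \<open>S = T\<close> by (simp only: pq)
  qed
  moreover have "(\<lambda>(F, S). sym_diff F S) ` ?Z = Pow (ground D)"
  proof
    show "(\<lambda>(F, S). sym_diff F S) ` ?Z \<subseteq> Pow (ground D)" using sub by fastforce
    show "Pow (ground D) \<subseteq> (\<lambda>(F, S). sym_diff F S) ` ?Z"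
    proof
      fix A assume "A \<in> Pow (ground D)"
      then have "A \<subseteq> ground D" by simp
      then have D': "delta_matroid (twist D A)" by (rule delta_matroid_twist[OF D])
      have "strict_linear_order_on (ground (twist D A)) r" using r by simp
      from ex_active_orientable[OF D' this] obtain S
        where S: "S \<in> feasible (twist D A)" "S \<subseteq> active_orientable (twist D A) r S" ..
      have "(sym_diff A S, S) \<in> ?Z"
        using S unfolding mem_feasible_twist active_orientable_twist by (intro SigmaI PowI)
      moreover have "A = sym_diff (sym_diff A S) S" by auto
      ultimately show "A \<in> (\<lambda>(F, S). sym_diff F S) ` ?Z"
        by (intro image_eqI[where x = "(sym_diff A S, S)"]) (simp_all only: prod.case)
    qed
  qed
  ultimately show ?thesis unfolding bij_betw_def ..
qed

text \<open>In the twist by \<open>sym_diff F S\<close>, the set \<open>S\<close> is the feasible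
  set whose points are all active and orientable, so it has minimum cardinality.\<close>

lemma r_min_twist_sym_diff:
  assumes D: "delta_matroid D" and r: "strict_linear_order_on (ground D) r"
    and F: "F \<in> feasible D" and S: "S \<subseteq> active_orientable D r F"
  shows "r_min (twist D (sym_diff F S)) = card S"
proof -
  have "sym_diff F S \<subseteq> ground D"
    using S feasible_subset_ground[OF D F] by (auto simp: active_orientable_def)
  note D' = delta_matroid_twist[OF D this]
  have eq: "sym_diff (sym_diff F S) S = F" by blast
  show ?thesis
    by (rule card_eq_r_min_if_active_orientable[OF D', of r, symmetric])
      (simp_all only: ground_twist r mem_feasible_twist active_orientable_twist eq F S)
qed

section \<open>Evaluating the sum\<close>

lemma power_card_sym_diff:
  fixes x y :: "'b :: field"
  assumes "x \<noteq> 0" "finite F" "finite S"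
  shows "x ^ card (sym_diff F S) * y ^ card S =
    x ^ card F * (\<Prod>a\<in>S. if a \<in> F then y / x else x * y)"
  using assms(3)
proof (induction S)
  case (insert a S)
  show ?case
  proof (cases "a \<in> F")
    case True
    \<comment> \<open>Adding an internal point to \<open>S\<close> shrinks the symmetric difference,
      so the old set is written as the new one plus \<open>a\<close>. The lost factor
      \<open>x\<close> is the source of \<open>y / x\<close>; an external point contributes
      \<open>x * y\<close> instead.\<close>
    then have "sym_diff F S = insert a (sym_diff F (insert a S))"
      and "a \<notin> sym_diff F (insert a S)"
      using insert.hyps by auto
    then have "card (sym_diff F S) = Suc (card (sym_diff F (insert a S)))"
      using assms(2) insert.hyps by (metis card_insert_disjoint finite_Diff finite_UnI finite_insert)
    then show ?thesis using insert True assms(1) by (simp add: field_simps)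
  next
    case False
    then have "sym_diff F (insert a S) = insert a (sym_diff F S)" "a \<notin> sym_diff F S"
      using insert.hyps by auto
    then have "card (sym_diff F (insert a S)) = Suc (card (sym_diff F S))"
      using assms(2) insert.hyps by (metis card_insert_disjoint finite_Diff finite_UnI)
    then show ?thesis using insert False by (simp add: algebra_simps)
  qed
qed simp

lemma sum_Pow_active_orientable:
  fixes x y :: "'b :: field"
  assumes D: "delta_matroid D" and F: "F \<in> feasible D" and x: "x \<noteq> 0"
  shows "(\<Sum>S\<in>Pow (active_orientable D r F). x ^ card (sym_diff F S) * y ^ card S) =
    x ^ card F * (1 + y / x) ^ internal_activity D r F * (1 + x * y) ^ external_activity D r F"
proof -
  let ?U = "active_orientable D r F"
  let ?t = "\<lambda>a. if a \<in> F then y / x else x * y"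
  have fin: "finite ?U" using finite_ground[OF D] by (simp add: active_orientable_def)
  have "(\<Sum>S\<in>Pow ?U. x ^ card (sym_diff F S) * y ^ card S) =
      (\<Sum>S\<in>Pow ?U. x ^ card F * (\<Prod>a\<in>S. ?t a))"
    using power_card_sym_diff[OF x finite_feasible_set[OF D F]] fin
    by (intro sum.cong) (auto dest: finite_subset)
  \<comment> \<open>Summing products of weights over all subsets expands the product of the factors
    \<open>?t a + 1\<close>, where 1 stands for leaving \<open>a\<close> out.\<close>
  also have "\<dots> = x ^ card F * (\<Prod>a\<in>?U. ?t a + 1)"
    using fin by (simp add: sum_distrib_left prod_add)
  also have "(\<Prod>a\<in>?U. ?t a + 1) = (\<Prod>a\<in>?U. if a \<in> F then 1 + y / x else 1 + x * y)"
    by (intro prod.cong) auto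
  also have "\<dots> = (1 + y / x) ^ card (?U \<inter> F) * (1 + x * y) ^ card (?U \<inter> - F)"
    using fin by (simp add: prod.If_cases)
  also have "card (?U \<inter> F) = internal_activity D r F"
    unfolding internal_activity_def active_orientable_def by (rule arg_cong[of _ _ card]) blast
  also have "card (?U \<inter> - F) = external_activity D r F"
    unfolding external_activity_def active_orientable_def by (rule arg_cong[of _ _ card]) blast
  finally show ?thesis by (simp add: mult.assoc)
qed

theorem theorem5p2:
  fixes D :: "'a set_system" and r :: "'a rel"
  assumes "delta_matroid D"
    and "strict_linear_order_on (ground D) r"
  shows "to_fract (interlace_poly D) =
    (\<Sum>F\<in>feasible D. frac_x ^ card F
       * (1 + frac_y / frac_x) ^ internal_activity D r F
       * (1 + frac_x * frac_y) ^ external_activity D r F)"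
proof -
  note D = assms(1) and r = assms(2)
  have x: "frac_x \<noteq> 0" by (simp add: poly_x_def)
  \<comment> \<open>Together with \<open>hom\<close>, this moves the polynomial sum into the field
    of fractions, where the quotient by \<open>frac_x\<close> is available.\<close>
  have pow: "to_fract (p ^ n) = to_fract p ^ n" for p :: "int poly poly" and n
    by (induction n) simp_all
  have fin: "finite (active_orientable D r F)" for F
    using finite_ground[OF D] by (simp add: active_orientable_def)
  have hom: "to_fract (sum f A) = (\<Sum>a\<in>A. to_fract (f a))"
    for f :: "'a set \<Rightarrow> int poly poly" and A
    by (induction A rule: infinite_finite_induct) simp_all
  have "to_fract (interlace_poly D) =
      (\<Sum>A\<in>Pow (ground D). frac_x ^ card A * frac_y ^ r_min (twist D A))"
    by (simp add: interlace_poly_def hom pow)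
  \<comment> \<open>Each \<open>A\<close> is replaced by its unique representation as
    \<open>sym_diff F S\<close>.\<close>
  also have "\<dots> = (\<Sum>(F, S)\<in>(SIGMA F : feasible D. Pow (active_orientable D r F)).
      frac_x ^ card (sym_diff F S) * frac_y ^ r_min (twist D (sym_diff F S)))"
    using sum.reindex_bij_betw[OF bij_betw_active_orientable[OF D r], symmetric,
        of "\<lambda>A. frac_x ^ card A * frac_y ^ r_min (twist D A)"]
    by (simp add: case_prod_unfold)
  also have "\<dots> = (\<Sum>F\<in>feasible D. \<Sum>S\<in>Pow (active_orientable D r F).
      frac_x ^ card (sym_diff F S) * frac_y ^ r_min (twist D (sym_diff F S)))"
    using finite_feasible[OF D] fin by (subst sum.Sigma) auto
  also have "\<dots> = (\<Sum>F\<in>feasible D. \<Sum>S\<in>Pow (active_orientable D r F).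
      frac_x ^ card (sym_diff F S) * frac_y ^ card S)"
    using r_min_twist_sym_diff[OF D r] by (intro sum.cong) auto
  also have "\<dots> = (\<Sum>F\<in>feasible D. frac_x ^ card F
       * (1 + frac_y / frac_x) ^ internal_activity D r F
       * (1 + frac_x * frac_y) ^ external_activity D r F)"
    using sum_Pow_active_orientable[OF D _ x] by (intro sum.cong) auto
  finally show ?thesis .
qed

end
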